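(* Let $s\ge1$, let $a_{ij},b_i\in\mathbb{R}$ $(i,j=1,\dots,s)$, let $c_i=\sum_{j=1}^s a_{ij}$ be distinct, and let $M>0$ be an integer. Let $(\phi^n,p^n)\in\mathbb{C}^{N_xN_y}\times\mathbb{R}$, $n=0,1,2,\dots$, be produced, from given $(\phi^0,p^0)$ and time step $\tau>0$, by the following linearly implicit prediction-correction integrating factor Runge-Kutta method. 1. Prediction: set $\phi_{ni}^{(0)}=\phi^n$, $i=1,\dots,s$, and for $l=0,1,\dots,M-1$ and $i=1,\dots,s$ compute $$l_i^{(l+1)}=2\,\mathrm{Re}\Big\langle\mathrm{i}\mathcal{L}_h\phi_{ni}^{(l)},\frac{|\phi_{ni}^{(l)}|^2\cdot\phi_{ni}^{(l)}}{\sqrt{\langle(\phi_{ni}^{(l)})^2,(\phi_{ni}^{(l)})^2\rangle_h+C_0}}\Big\rangle_h,\qquad p_{ni}^{(l+1)}=p^n+\tau\sum_{j=1}^s a_{ij}l_j^{(l+1)},$$ $$k_i^{(l+1)}=\mathrm{i}\,\frac{\beta|\phi_{ni}^{(l)}|^2\cdot\phi_{ni}^{(l)}\,p_{ni}^{(l+1)}}{\sqrt{\langle(\phi_{ni}^{(l)})^2,(\phi_{ni}^{(l)})^2\rangle_h+C_0}},\qquad \phi_{ni}^{(l+1)}=\exp(\mathrm{i}\mathcal{L}_hc_i\tau)\phi^n+\tau\sum_{j=1}^s a_{ij}\exp(\mathrm{i}\mathcal{L}_h(c_i-c_j)\tau)k_j^{(l+1)},$$ and set $\phi_{ni}^*=\phi_{ni}^{(M)}$,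 $i=1,\dots,s$. 2. Correction: for $i=1,\dots,s$, $$\phi_{ni}=\exp(\mathrm{i}\mathcal{L}_hc_i\tau)\phi^n+\tau\sum_{j=1}^s a_{ij}\exp(\mathrm{i}\mathcal{L}_h(c_i-c_j)\tau)k_j,\qquad p_{ni}=p^n+\tau\sum_{j=1}^s a_{ij}l_j,$$ $$k_i=\mathrm{i}\,\frac{\beta|\phi_{ni}^*|^2\cdot\phi_{ni}^*\,p_{ni}}{\sqrt{\langle(\phi_{ni}^* )^2,(\phi_{ni}^* )^2\rangle_h+C_0}},\qquad l_i=2\,\mathrm{Re}\Big\langle\mathrm{i}\mathcal{L}_h\phi_{ni},\frac{|\phi_{ni}^*|^2\cdot\phi_{ni}^*}{\sqrt{\langle(\phi_{ni}^* )^2,(\phi_{ni}^* )^2\rangle_h+C_0}}\Big\rangle_h,$$ and $$\phi^{n+1}=\exp(\mathrm{i}\mathcal{L}_h\tau)\phi^n+\tau\sum_{i=1}^s b_i\exp(\mathrm{i}\mathcal{L}_h(1-c_i)\tau)k_i,\qquad p^{n+1}=p^n+\tau\sum_{i=1}^s b_il_i.$$ If $$b_ia_{ij}+b_ja_{ji}=b_ib_j\qquad\text{for all } i,j=1,\dots,s,$$ then the scheme preserves the discrete quadratic energy: $E_h^n=E_h^0$ for all $n=0,1,2,\dots$, where $$E_h^n=\langle\mathcal{L}_h\phi^n,\phi^n\rangle_h+\frac{\beta}{2}(p^n)^2-\frac{\beta}{2}C_0 .$$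
   Context: Let $\Omega=[a,b]\times[c,d]$, $l_x=b-a$, $l_y=d-c$, let $N_x,N_y$ be even positive integers, $h_x=l_x/N_x$, $h_y=l_y/N_y$, $x_j=jh_x$, $y_k=kh_y$, $\mu_x=2\pi/l_x$, $\mu_y=2\pi/l_y$. Grid functions $(\phi_{j,k})$, $0\le j\le N_x-1$, $0\le k\le N_y-1$, are identified with vectors in $\mathbb{C}^{N_xN_y}$ (index $j$ running fastest). The discrete inner product is $\langle\phi,\psi\rangle_h=h_xh_y\sum_{j=0}^{N_x-1}\sum_{k=0}^{N_y-1}\phi_{j,k}\bar\psi_{j,k}$. The symbol $\cdot$ is the entrywise product, $\phi^2=\phi\cdot\phi$, $|\phi|^2=\phi\cdot\bar\phi$. The spectral differentiation matrix is $\mathcal{L}_h=I_{N_y}\otimes D_2^x+D_2^y\otimes I_{N_x}$ ($\otimes$ the Kronecker product, $I_N$ the identity), where $D_2^x\in\mathbb{R}^{N_x\times N_x}$ has entries $$(D_2^x)_{j,k}=\tfrac12\mu_x^2(-1)^{j+k+1}\csc^2\Big(\mu_x\frac{x_j-x_k}{2}\Big)\ (j\ne k),\qquad (D_2^x)_{j,j}=-\mu_x^2\frac{N_x^2+2}{12},$$ and $D_2^y\in\mathbb{R}^{N_y\times N_y}$ is defined in the same way with $x$ replaced by $y$. $\exp$ is the matrix exponential. $\beta\in\mathbb{R}$ is a constant, and $C_0\ge0$ is a constant such that the quantities under the square roots are positive. The correction-stage equations are assumed to be solved by $(\phi_{ni},p_{ni},k_i,l_i)$ at every step. *)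

theory Defs
  imports Complex_Main "Jordan_Normal_Form.Matrix"
begin

text \<open>
  A grid function \<open>\<phi>\<^sub>j\<^sub>,\<^sub>k\<close> (\<open>j < Nx\<close>, \<open>k < Ny\<close>) is the vector of dimension \<open>Nx * Ny\<close>
  whose entry with index \<open>j + Nx * k\<close> is \<open>\<phi>\<^sub>j\<^sub>,\<^sub>k\<close>, i.e. \<open>j\<close> runs fastest.
\<close>

definition inner_h :: "real \<Rightarrow> real \<Rightarrow> nat \<Rightarrow> nat \<Rightarrow> complex vec \<Rightarrow> complex vec \<Rightarrow> complex" where
  "inner_h hx hy Nx Ny \<phi> \<psi> =
     of_real (hx * hy) *
       (\<Sum>j = 0..<Nx. \<Sum>k = 0..<Ny. \<phi> $ (j + Nx * k) * cnj (\<psi> $ (j + Nx * k)))"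

definition abs_sq :: "complex vec \<Rightarrow> complex vec" where
  "abs_sq \<phi> = component_mult \<phi> (conjugate \<phi>)"

text \<open>
  The Kronecker product with the usual block layout \<open>(A\<^sub>i\<^sub>j B)\<^sub>i\<^sub>j\<close>: the index of the second
  factor runs fastest.
\<close>

definition kron :: "'a :: times mat \<Rightarrow> 'a mat \<Rightarrow> 'a mat" where
  "kron A B = mat (dim_row A * dim_row B) (dim_col A * dim_col B)
     (\<lambda>(r, q). A $$ (r div dim_row B, q div dim_col B) * B $$ (r mod dim_row B, q mod dim_col B))"

text \<open>One-dimensional second-order spectral differentiation matrix on \<open>N\<close> points, period \<open>len\<close>.\<close>

definition D2 :: "real \<Rightarrow> nat \<Rightarrow> real mat" where
  "D2 len N =
     (let \<mu> = 2 * pi / len; x = (\<lambda>j. real j * (len / real N))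
      in mat N N (\<lambda>(j, k).
           if j = k then - (\<mu>\<^sup>2 * ((real N)\<^sup>2 + 2) / 12)
           else 1 / 2 * \<mu>\<^sup>2 * (- 1) ^ (j + k + 1) * (1 / sin (\<mu> * ((x j - x k) / 2)))\<^sup>2))"

text \<open>The matrix \<open>\<L>\<^sub>h\<close>, a real matrix regarded as a complex one so that it acts on grid functions.\<close>

definition lap_h :: "real \<Rightarrow> real \<Rightarrow> nat \<Rightarrow> nat \<Rightarrow> complex mat" where
  "lap_h lx ly Nx Ny =
     map_mat complex_of_real (kron (1\<^sub>m Ny) (D2 lx Nx) + kron (D2 ly Ny) (1\<^sub>m Nx))"

text \<open>
  The matrix exponential of a square matrix, as its entrywise power series, which converges by
  the lemma that follows.
\<close>

definition mat_exp :: "complex mat \<Rightarrow> complex mat" where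
  "mat_exp A = mat (dim_row A) (dim_row A) (\<lambda>(i, j). \<Sum>m. (A ^\<^sub>m m) $$ (i, j) / fact m)"

lemma summable_mat_exp:
  fixes A :: "complex mat"
  assumes A: "A \<in> carrier_mat n n" and i: "i < n" and j: "j < n"
  shows "summable (\<lambda>m. (A ^\<^sub>m m) $$ (i, j) / fact m)"
proof -
  define B where "B = Max (insert 0 ((\<lambda>(i, j). norm (A $$ (i, j))) ` ({..<n} \<times> {..<n})))"
  have B: "norm (A $$ (i, j)) \<le> B" if "i < n" "j < n" for i j
    unfolding B_def using that by (intro Max_ge) auto
  have B0: "0 \<le> B"
    unfolding B_def by (intro Max_ge) auto
  have pow: "A ^\<^sub>m m \<in> carrier_mat n n" for m
    using A by simp
  have bound: "norm ((A ^\<^sub>m m) $$ (i, j)) \<le> (real n * B) ^ m" if "i < n" "j < n" for m i j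
    using that
  proof (induction m arbitrary: i j)
    case 0
    then show ?case using A by simp
  next
    case (Suc m)
    have "(A ^\<^sub>m Suc m) $$ (i, j) = (\<Sum>k = 0..<n. (A ^\<^sub>m m) $$ (i, k) * A $$ (k, j))"
      using A pow[of m] Suc.prems by (simp add: scalar_prod_def)
    also have "norm \<dots> \<le> (\<Sum>k = 0..<n. (real n * B) ^ m * B)"
      using Suc.IH Suc.prems B B0
      by (intro sum_norm_le) (auto simp: norm_mult intro!: mult_mono)
    finally show ?case by (simp add: mult_ac)
  qed
  show ?thesis
  proof (rule summable_comparison_test')
    show "summable (\<lambda>m. (real n * B) ^ m / fact m)"
      using summable_exp[of "real n * B"] by (simp add: field_simps)
    show "norm ((A ^\<^sub>m m) $$ (i, j) / fact m) \<le> (real n * B) ^ m / fact m" if "m \<ge> 0" for m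
      using bound[OF i j, of m] by (simp add: norm_divide divide_right_mono)
  qed
qed

text \<open>
  The quantity under the square roots: \<open>\<langle>\<phi>\<^sup>2, \<phi>\<^sup>2\<rangle>\<^sub>h + C\<^sub>0\<close>. The inner product of a vector with itself
  is a nonnegative real number, so \<open>Re\<close> is only a change of type.
\<close>

definition radicand :: "real \<Rightarrow> real \<Rightarrow> nat \<Rightarrow> nat \<Rightarrow> real \<Rightarrow> complex vec \<Rightarrow> real" where
  "radicand hx hy Nx Ny C0 \<phi> =
     Re (inner_h hx hy Nx Ny (component_mult \<phi> \<phi>) (component_mult \<phi> \<phi>)) + C0"

text \<open>\<open>|\<phi>|\<^sup>2 \<cdot> \<phi> / sqrt (\<langle>\<phi>\<^sup>2, \<phi>\<^sup>2\<rangle>\<^sub>h + C\<^sub>0)\<close>\<close>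

definition normalized_cubic ::
  "real \<Rightarrow> real \<Rightarrow> nat \<Rightarrow> nat \<Rightarrow> real \<Rightarrow> complex vec \<Rightarrow> complex vec" where
  "normalized_cubic hx hy Nx Ny C0 \<phi> =
     of_real (1 / sqrt (radicand hx hy Nx Ny C0 \<phi>)) \<cdot>\<^sub>v component_mult (abs_sq \<phi>) \<phi>"

text \<open>
  The discrete quadratic energy, kept complex-valued since \<open>inner_h\<close> is. The last argument
  stands for \<open>p\<^sup>n\<close>.
\<close>

definition energy_h ::
  "real \<Rightarrow> real \<Rightarrow> nat \<Rightarrow> nat \<Rightarrow> complex mat \<Rightarrow> real \<Rightarrow> real \<Rightarrow> complex vec \<Rightarrow> real \<Rightarrow> complex" where
  "energy_h hx hy Nx Ny L \<beta> C0 \<phi> q =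
     inner_h hx hy Nx Ny (L *\<^sub>v \<phi>) \<phi> + of_real (\<beta> / 2 * q\<^sup>2) - of_real (\<beta> / 2 * C0)"

end

theory Submission
  imports Defs
begin

text \<open>
  The matrix \<open>\<L>\<^sub>h\<close> is Hermitian, so \<open>exp (\<i> \<L>\<^sub>h t)\<close> is unitary and commutes with \<open>\<L>\<^sub>h\<close>, hence
  preserves the form \<open>\<langle>\<L>\<^sub>h u, v\<rangle>\<^sub>h\<close>. In the variables \<open>\<kappa>\<^sub>i = exp (- \<i> \<L>\<^sub>h c\<^sub>i \<tau>) k\<^sub>i\<close> the
  correction stage is a classical Runge-Kutta step, and the symplecticity condition cancels the
  terms of order \<open>\<tau>\<^sup>2\<close> in its quadratic quantities. The increment of \<open>\<langle>\<L>\<^sub>h \<phi>, \<phi>\<rangle>\<^sub>h\<close> is then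
  \<open>2 \<tau> \<Sum> b\<^sub>i Re \<langle>\<L>\<^sub>h \<phi>\<^sub>n\<^sub>i, k\<^sub>i\<rangle>\<^sub>h = - \<beta> \<tau> \<Sum> b\<^sub>i p\<^sub>n\<^sub>i l\<^sub>i\<close>, and that of \<open>\<beta>/2 p\<^sup>2\<close> is its negative.
  The predicted values enter only through a common factor of \<open>k\<^sub>i\<close> and \<open>l\<^sub>i\<close>, so how they are
  computed is immaterial.
\<close>

section \<open>The exponential of the multiples of a matrix\<close>

lemma smult_pow_mat:
  fixes A :: "'a :: comm_semiring_1 mat"
  assumes A: "A \<in> carrier_mat n n"
  shows "(z \<cdot>\<^sub>m A) ^\<^sub>m m = z ^ m \<cdot>\<^sub>m (A ^\<^sub>m m)"
proof (induction m)
  case (Suc m)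
  have P: "A ^\<^sub>m m \<in> carrier_mat n n" using A by simp
  have "z \<cdot>\<^sub>m (z ^ m \<cdot>\<^sub>m B) = z ^ Suc m \<cdot>\<^sub>m B" for B :: "'a mat"
    by (rule eq_matI) (simp_all add: mult_ac)
  then show ?case using A P
    by (simp add: Suc mult_smult_assoc_mat[of _ n n _ n] mult_smult_distrib[of _ n n _ n])
qed (use A in auto)

lemma pow_mat_add:
  fixes A :: "'a :: semiring_1 mat"
  assumes A: "A \<in> carrier_mat n n"
  shows "A ^\<^sub>m (k + l) = A ^\<^sub>m k * A ^\<^sub>m l"
proof (induction l)
  case (Suc l)
  have P: "A ^\<^sub>m k \<in> carrier_mat n n" "A ^\<^sub>m l \<in> carrier_mat n n" using A by simp_all
  show ?case using A P by (simp add: Suc assoc_mult_mat[of _ n n _ n _ n])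
qed (use A in auto)

lemma mat_exp_carrier [simp]: "A \<in> carrier_mat n n \<Longrightarrow> mat_exp A \<in> carrier_mat n n"
  by (simp add: mat_exp_def)

lemma index_mat_exp_smult:
  assumes A: "A \<in> carrier_mat n n" and "i < n" "j < n"
  shows "mat_exp (z \<cdot>\<^sub>m A) $$ (i, j) = (\<Sum>m. z ^ m * (A ^\<^sub>m m) $$ (i, j) / fact m)"
  using assms by (simp add: mat_exp_def smult_pow_mat[OF A])

lemma summable_mat_exp_smult:
  fixes A :: "complex mat"
  assumes A: "A \<in> carrier_mat n n" and "i < n" "j < n"
  shows "summable (\<lambda>m. z ^ m * (A ^\<^sub>m m) $$ (i, j) / fact m)"
  using summable_mat_exp[of "z \<cdot>\<^sub>m A" n i j] assms by (simp add: smult_pow_mat[OF A])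

text \<open>Each entry is a power series in \<open>z\<close>. It converges at the point
  \<open>norm z + 1\<close>, which has larger modulus than \<open>z\<close>, so it converges
  absolutely at \<open>z\<close>. Absolute convergence is what the Cauchy product of two such series
  needs.\<close>

lemma summable_norm_mat_exp_smult:
  fixes A :: "complex mat"
  assumes A: "A \<in> carrier_mat n n" and ij: "i < n" "j < n"
  shows "summable (\<lambda>m. norm (z ^ m * (A ^\<^sub>m m) $$ (i, j) / fact m))"
proof -
  have "summable (\<lambda>m. ((A ^\<^sub>m m) $$ (i, j) / fact m) * complex_of_real (norm z + 1) ^ m)"
    using summable_mat_exp_smult[OF A ij, of "complex_of_real (norm z + 1)"]
    by (simp add: mult_ac)
  moreover have "norm z < norm (complex_of_real (norm z + 1))"
    by (subst norm_of_real) simp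
  ultimately have "summable (\<lambda>m. norm (((A ^\<^sub>m m) $$ (i, j) / fact m) * z ^ m))"
    by (rule powser_insidea)
  then show ?thesis by (simp add: mult_ac)
qed

text \<open>Multiples of one matrix commute, so the binomial theorem turns each term of the series
  at \<open>w + z\<close> into terms of Cauchy products, one product for every inner index
  \<open>k\<close> of the matrix multiplication.\<close>

lemma mat_exp_smult_add:
  fixes A :: "complex mat"
  assumes A: "A \<in> carrier_mat n n"
  shows "mat_exp ((w + z) \<cdot>\<^sub>m A) = mat_exp (w \<cdot>\<^sub>m A) * mat_exp (z \<cdot>\<^sub>m A)"
proof (rule eq_matI)
  fix i j assume "i < dim_row (mat_exp (w \<cdot>\<^sub>m A) * mat_exp (z \<cdot>\<^sub>m A))"
    and "j < dim_col (mat_exp (w \<cdot>\<^sub>m A) * mat_exp (z \<cdot>\<^sub>m A))"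
  then have i: "i < n" and j: "j < n" using A by (simp_all add: mat_exp_def)
  define T where "T z i j m = z ^ m * (A ^\<^sub>m m) $$ (i, j) / fact m" for z i j m
  \<comment> \<open>The power may be split at any \<open>r\<close>; in the binomial sum below the
    split varies with the summation index.\<close>
  have pow: "(A ^\<^sub>m m) $$ (i, j) = (\<Sum>k<n. (A ^\<^sub>m r) $$ (i, k) * (A ^\<^sub>m (m - r)) $$ (k, j))"
    if "r \<le> m" for r m
  proof -
    have P: "A ^\<^sub>m r \<in> carrier_mat n n" "A ^\<^sub>m (m - r) \<in> carrier_mat n n" using A by simp_all
    have "A ^\<^sub>m m = A ^\<^sub>m r * A ^\<^sub>m (m - r)"
      using pow_mat_add[OF A, of r "m - r"] that by simp
    then show ?thesis using P A i j
      by (simp add: scalar_prod_def atLeast0LessThan)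
  qed
  have binom: "T (w + z) i j m = (\<Sum>k<n. \<Sum>r\<le>m. T w i k r * T z k j (m - r))" for m
  proof -
    have "T (w + z) i j m
        = (\<Sum>r\<le>m. w ^ r * z ^ (m - r) / (fact r * fact (m - r)) * (A ^\<^sub>m m) $$ (i, j))"
      unfolding T_def binomial_ring sum_distrib_right sum_divide_distrib
      by (intro sum.cong refl) (simp add: binomial_fact field_simps)
    also have "\<dots> = (\<Sum>r\<le>m. \<Sum>k<n. T w i k r * T z k j (m - r))"
      by (intro sum.cong refl)
        (simp add: pow T_def sum_distrib_left sum_distrib_right mult_ac)
    finally show ?thesis by (subst sum.swap)
  qed
  have "(\<lambda>m. \<Sum>k<n. \<Sum>r\<le>m. T w i k r * T z k j (m - r)) sums
      (\<Sum>k<n. (\<Sum>m. T w i k m) * (\<Sum>m. T z k j m))"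
    unfolding T_def using A i j
    by (intro sums_sum Cauchy_product_sums summable_norm_mat_exp_smult) auto
  then have "(\<Sum>m. T (w + z) i j m) = (\<Sum>k<n. (\<Sum>m. T w i k m) * (\<Sum>m. T z k j m))"
    unfolding binom by (rule sums_unique[symmetric])
  moreover have "mat_exp (x \<cdot>\<^sub>m A) $$ (i, j) = (\<Sum>m. T x i j m)" if "i < n" "j < n" for x i j
    using index_mat_exp_smult[OF A that] by (simp add: T_def)
  moreover have "mat_exp (w \<cdot>\<^sub>m A) \<in> carrier_mat n n" "mat_exp (z \<cdot>\<^sub>m A) \<in> carrier_mat n n"
    using A by simp_all
  ultimately show "mat_exp ((w + z) \<cdot>\<^sub>m A) $$ (i, j) = (mat_exp (w \<cdot>\<^sub>m A) * mat_exp (z \<cdot>\<^sub>m A)) $$ (i, j)"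
    using i j by (simp add: scalar_prod_def atLeast0LessThan)
qed (use A in \<open>simp_all add: mat_exp_def\<close>)

lemma mat_exp_smult_0:
  fixes A :: "complex mat"
  assumes A: "A \<in> carrier_mat n n"
  shows "mat_exp (0 \<cdot>\<^sub>m A) = 1\<^sub>m n"
proof (rule eq_matI)
  fix i j assume "i < dim_row (1\<^sub>m n :: complex mat)" "j < dim_col (1\<^sub>m n :: complex mat)"
  then have ij: "i < n" "j < n" by simp_all
  have "mat_exp (0 \<cdot>\<^sub>m A) $$ (i, j) = (\<Sum>m. (A ^\<^sub>m m) $$ (i, j) / fact m * 0 ^ m)"
    using index_mat_exp_smult[OF A ij, of 0] by (simp add: mult_ac)
  also have "\<dots> = 1\<^sub>m n $$ (i, j)"
    \<comment> \<open>At zero only the constant term of the power series survives, and this is the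
      zeroth power of \<open>A\<close>.\<close>
    using A by (subst powser_zero) simp
  finally show "mat_exp (0 \<cdot>\<^sub>m A) $$ (i, j) = 1\<^sub>m n $$ (i, j)" .
qed (use A in \<open>simp_all add: mat_exp_def\<close>)

text \<open>\<open>A\<close> commutes with each of its powers, so both products are limits of the
  same series, entry by entry.\<close>

lemma mat_exp_smult_commute:
  fixes A :: "complex mat"
  assumes A: "A \<in> carrier_mat n n"
  shows "A * mat_exp (z \<cdot>\<^sub>m A) = mat_exp (z \<cdot>\<^sub>m A) * A"
proof (rule eq_matI)
  fix i j assume "i < dim_row (mat_exp (z \<cdot>\<^sub>m A) * A)" "j < dim_col (mat_exp (z \<cdot>\<^sub>m A) * A)"
  then have i: "i < n" and j: "j < n" using A by (simp_all add: mat_exp_def)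
  have E: "mat_exp (z \<cdot>\<^sub>m A) \<in> carrier_mat n n" using A by simp
  have S: "(\<lambda>m. z ^ m * (A ^\<^sub>m m) $$ (i, j) / fact m) sums mat_exp (z \<cdot>\<^sub>m A) $$ (i, j)"
    if "i < n" "j < n" for i j
    unfolding index_mat_exp_smult[OF A that] using summable_mat_exp_smult[OF A that]
    by (rule summable_sums)
  have pow: "(\<Sum>k<n. A $$ (i, k) * (z ^ m * (A ^\<^sub>m m) $$ (k, j) / fact m)) =
      (\<Sum>k<n. (z ^ m * (A ^\<^sub>m m) $$ (i, k) / fact m) * A $$ (k, j))" for m
  proof -
    have P: "A ^\<^sub>m m \<in> carrier_mat n n" using A by simp
    have "A * A ^\<^sub>m m = A ^\<^sub>m m * A"
      using pow_mat_add[OF A, of 1 m] pow_mat_add[OF A, of m 1] A by simp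
    then have "(A * A ^\<^sub>m m) $$ (i, j) = (A ^\<^sub>m m * A) $$ (i, j)" by simp
    then have "(\<Sum>k<n. A $$ (i, k) * (A ^\<^sub>m m) $$ (k, j)) = (\<Sum>k<n. (A ^\<^sub>m m) $$ (i, k) * A $$ (k, j))"
      using A P i j by (simp add: scalar_prod_def atLeast0LessThan)
    then have "z ^ m / fact m * (\<Sum>k<n. A $$ (i, k) * (A ^\<^sub>m m) $$ (k, j)) =
        z ^ m / fact m * (\<Sum>k<n. (A ^\<^sub>m m) $$ (i, k) * A $$ (k, j))" by simp
    then show ?thesis by (simp add: sum_distrib_left mult_ac)
  qed
  have "(\<lambda>m. \<Sum>k<n. A $$ (i, k) * (z ^ m * (A ^\<^sub>m m) $$ (k, j) / fact m)) sums
      (\<Sum>k<n. A $$ (i, k) * mat_exp (z \<cdot>\<^sub>m A) $$ (k, j))"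
    using j by (intro sums_sum sums_mult S) auto
  moreover have "(\<lambda>m. \<Sum>k<n. (z ^ m * (A ^\<^sub>m m) $$ (i, k) / fact m) * A $$ (k, j)) sums
      (\<Sum>k<n. mat_exp (z \<cdot>\<^sub>m A) $$ (i, k) * A $$ (k, j))"
    using i by (intro sums_sum sums_mult2 S) auto
  ultimately have "(\<Sum>k<n. A $$ (i, k) * mat_exp (z \<cdot>\<^sub>m A) $$ (k, j)) =
      (\<Sum>k<n. mat_exp (z \<cdot>\<^sub>m A) $$ (i, k) * A $$ (k, j))"
    unfolding pow by (rule sums_unique2)
  then show "(A * mat_exp (z \<cdot>\<^sub>m A)) $$ (i, j) = (mat_exp (z \<cdot>\<^sub>m A) * A) $$ (i, j)"
    using A carrier_matD[OF E] i j by (simp add: scalar_prod_def atLeast0LessThan)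
qed (use A in \<open>simp_all add: mat_exp_def\<close>)

section \<open>Finite sums of vectors\<close>

lemma finsum_vec_cong:
  assumes "finite I" "f \<in> I \<rightarrow> carrier_vec n" "\<And>i. i \<in> I \<Longrightarrow> g i = f i"
  shows "finsum_vec TYPE('a :: comm_monoid_add) n g I = finsum_vec TYPE('a) n f I"
proof -
  have "g \<in> I \<rightarrow> carrier_vec n" using assms by auto
  then show ?thesis
    using assms finsum_vec_closed[of f I n] finsum_vec_closed[of g I n]
    by (intro eq_vecI) (auto simp: index_finsum_vec)
qed

lemma mult_mat_vec_finsum_vec:
  fixes A :: "'a :: semiring_0 mat"
  assumes A: "A \<in> carrier_mat m n" and "finite I" and f: "f \<in> I \<rightarrow> carrier_vec n"
  shows "A *\<^sub>v finsum_vec TYPE('a) n f I = finsum_vec TYPE('a) m (\<lambda>i. A *\<^sub>v f i) I"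
  using assms(2) f
proof (induction I rule: finite_induct)
  case empty
  show ?case unfolding finsum_vec_empty using A by (intro eq_vecI) auto
next
  case (insert i I)
  then have "f \<in> I \<rightarrow> carrier_vec n" "f i \<in> carrier_vec n"
    "(\<lambda>i. A *\<^sub>v f i) \<in> I \<rightarrow> carrier_vec m" "A *\<^sub>v f i \<in> carrier_vec m"
    using A by (auto intro!: mult_mat_vec_carrier[OF A])
  then show ?case using insert A
    by (simp add: finsum_vec_insert finsum_vec_closed mult_add_distrib_mat_vec[OF A])
qed

section \<open>Hermitian matrices\<close>

definition hermitian_mat :: "complex mat \<Rightarrow> bool" where
  "hermitian_mat A \<longleftrightarrow> square_mat A \<and>
     (\<forall>i < dim_row A. \<forall>j < dim_row A. A $$ (j, i) = cnj (A $$ (i, j)))"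

lemma hermitian_matD:
  assumes "A \<in> carrier_mat n n" "hermitian_mat A" "i < n" "j < n"
  shows "A $$ (j, i) = cnj (A $$ (i, j))"
  using assms unfolding hermitian_mat_def by blast

lemma hermitian_pow_mat:
  assumes A: "A \<in> carrier_mat n n" "hermitian_mat A" and "i < n" "j < n"
  shows "(A ^\<^sub>m m) $$ (j, i) = cnj ((A ^\<^sub>m m) $$ (i, j))"
  using assms(3,4)
proof (induction m arbitrary: i j)
  case (Suc m)
  have P: "A ^\<^sub>m m \<in> carrier_mat n n" using A by simp
  \<comment> \<open>Taking adjoints reverses a product. The recursion puts the new factor on the
    right, so it has to be moved to the left before the induction hypothesis can be applied.\<close>
  have "A * A ^\<^sub>m m = A ^\<^sub>m m * A"
    using pow_mat_add[OF A(1), of 1 m] pow_mat_add[OF A(1), of m 1] A(1) by simp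
  then have "(A ^\<^sub>m Suc m) $$ (j, i) = (A * A ^\<^sub>m m) $$ (j, i)" by simp
  also have "\<dots> = (\<Sum>k = 0..<n. A $$ (j, k) * (A ^\<^sub>m m) $$ (k, i))"
    using A P Suc.prems by (simp add: scalar_prod_def)
  also have "\<dots> = (\<Sum>k = 0..<n. cnj ((A ^\<^sub>m m) $$ (i, k) * A $$ (k, j)))"
  proof (rule sum.cong[OF refl])
    fix k assume "k \<in> {0..<n}"
    then have "k < n" by simp
    then show "A $$ (j, k) * (A ^\<^sub>m m) $$ (k, i) = cnj ((A ^\<^sub>m m) $$ (i, k) * A $$ (k, j))"
      using Suc.IH[of i k] hermitian_matD[OF A, of k j] Suc.prems by simp
  qed
  also have "\<dots> = cnj ((A ^\<^sub>m Suc m) $$ (i, j))"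
    using A P Suc.prems by (simp add: scalar_prod_def)
  finally show ?case .
qed (use A in auto)

text \<open>Conjugating the series term by term conjugates \<open>z\<close> and transposes the
  powers. At \<open>z = \<i> * t\<close> with \<open>t\<close> real this says that the adjoint of
  exp(itA) is exp(-itA).\<close>

lemma hermitian_mat_exp_smult:
  assumes A: "A \<in> carrier_mat n n" "hermitian_mat A" and i: "i < n" and j: "j < n"
  shows "mat_exp (cnj z \<cdot>\<^sub>m A) $$ (j, i) = cnj (mat_exp (z \<cdot>\<^sub>m A) $$ (i, j))"
proof -
  have "(\<lambda>m. cnj (z ^ m * (A ^\<^sub>m m) $$ (i, j) / fact m)) sums cnj (mat_exp (z \<cdot>\<^sub>m A) $$ (i, j))"
    unfolding index_mat_exp_smult[OF A(1) i j] using summable_mat_exp_smult[OF A(1) i j]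
    by (intro summable_sums sums_cnj[THEN iffD2])
  then have "(\<lambda>m. cnj z ^ m * (A ^\<^sub>m m) $$ (j, i) / fact m) sums cnj (mat_exp (z \<cdot>\<^sub>m A) $$ (i, j))"
    by (simp add: hermitian_pow_mat[OF A i j])
  then show ?thesis
    unfolding index_mat_exp_smult[OF A(1) j i] by (rule sums_unique[symmetric])
qed

text \<open>Here \<open>B\<close> is the adjoint of \<open>A\<close>. Keeping it separate lets one
  lemma serve both a Hermitian matrix, where \<open>B = A\<close>, and the exponential, where
  \<open>B\<close> is its inverse.\<close>

lemma cscalar_prod_mult_mat_vec:
  fixes A B :: "complex mat"
  assumes A: "A \<in> carrier_mat n n" and B: "B \<in> carrier_mat n n"
    and adj: "\<And>i j. i < n \<Longrightarrow> j < n \<Longrightarrow> B $$ (j, i) = cnj (A $$ (i, j))"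
    and u: "u \<in> carrier_vec n" and v: "v \<in> carrier_vec n"
  shows "(A *\<^sub>v u) \<bullet>c v = u \<bullet>c (B *\<^sub>v v)"
proof -
  have "(A *\<^sub>v u) \<bullet>c v = (\<Sum>i<n. \<Sum>j<n. A $$ (i, j) * u $ j * cnj (v $ i))"
    using A u v by (simp add: scalar_prod_def atLeast0LessThan sum_distrib_right)
  also have "\<dots> = (\<Sum>j<n. \<Sum>i<n. A $$ (i, j) * u $ j * cnj (v $ i))"
    by (rule sum.swap)
  also have "\<dots> = u \<bullet>c (B *\<^sub>v v)"
    using B u v by (simp add: scalar_prod_def atLeast0LessThan sum_distrib_left adj mult_ac)
  finally show ?thesis .
qed

section \<open>The sesquilinear form of a matrix\<close>

lemma cscalar_prod_commute:
  fixes u v :: "complex vec"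
  assumes "u \<in> carrier_vec n" "v \<in> carrier_vec n"
  shows "v \<bullet>c u = cnj (u \<bullet>c v)"
  using assms by (simp add: scalar_prod_def mult.commute)

definition form :: "complex mat \<Rightarrow> complex vec \<Rightarrow> complex vec \<Rightarrow> complex" where
  "form A u v = (A *\<^sub>v u) \<bullet>c v"

lemma hermitian_form_commute:
  assumes "A \<in> carrier_mat n n" "hermitian_mat A" "u \<in> carrier_vec n" "v \<in> carrier_vec n"
  shows "form A v u = cnj (form A u v)"
proof -
  have "form A u v = u \<bullet>c (A *\<^sub>v v)"
    unfolding form_def using assms
    by (intro cscalar_prod_mult_mat_vec hermitian_matD)
  then show ?thesis
    using assms cscalar_prod_commute[of u n "A *\<^sub>v v"] by (simp add: form_def)
qed

lemma form_add_left:
  assumes "A \<in> carrier_mat n n" "u \<in> carrier_vec n" "v \<in> carrier_vec n" "w \<in> carrier_vec n"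
  shows "form A (u + v) w = form A u w + form A v w"
  using assms by (simp add: form_def mult_add_distrib_mat_vec add_scalar_prod_distrib[of _ n])

lemma form_smult_left:
  assumes "A \<in> carrier_mat n n" "u \<in> carrier_vec n" "v \<in> carrier_vec n"
  shows "form A (z \<cdot>\<^sub>v u) v = z * form A u v"
  using assms by (simp add: form_def mult_mat_vec)

lemma form_smult_right:
  assumes "A \<in> carrier_mat n n" "u \<in> carrier_vec n" "v \<in> carrier_vec n"
  shows "form A u (z \<cdot>\<^sub>v v) = cnj z * form A u v"
  using assms by (simp add: form_def conjugate_smult_vec)

lemma form_sum_left:
  assumes A: "A \<in> carrier_mat n n" and w: "w \<in> carrier_vec n" and "finite I"
    and f: "\<And>i. i \<in> I \<Longrightarrow> f i \<in> carrier_vec n"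
  shows "form A (finsum_vec TYPE(complex) n f I) w = (\<Sum>i\<in>I. form A (f i) w)"
  using assms(3) f
proof (induction I rule: finite_induct)
  case empty
  have "A *\<^sub>v 0\<^sub>v n = 0\<^sub>v n"
    using A by (intro eq_vecI) auto
  then show ?case using w by (simp add: finsum_vec_empty form_def)
next
  case (insert i I)
  then have "f \<in> I \<rightarrow> carrier_vec n" "f i \<in> carrier_vec n" by auto
  then show ?case using insert A w
    by (simp add: finsum_vec_insert form_add_left[of _ n] finsum_vec_closed)
qed

text \<open>For Hermitian \<open>A\<close> the matrix \<open>exp (\<i> t A)\<close> is unitary and commutes with \<open>A\<close>.\<close>

lemma form_mat_exp_isometry:
  fixes t :: real
  assumes A: "A \<in> carrier_mat n n" "hermitian_mat A"
    and u: "u \<in> carrier_vec n" and v: "v \<in> carrier_vec n"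
  defines "U \<equiv> mat_exp ((\<i> * of_real t) \<cdot>\<^sub>m A)"
  shows "form A (U *\<^sub>v u) (U *\<^sub>v v) = form A u v"
proof -
  define V where "V = mat_exp (cnj (\<i> * of_real t) \<cdot>\<^sub>m A)"
  have UV: "U \<in> carrier_mat n n" "V \<in> carrier_mat n n"
    using A by (simp_all add: U_def V_def)
  \<comment> \<open>The two exponents are conjugate and purely imaginary, so they add up to zero:
    the adjoint \<open>V\<close> inverts \<open>U\<close>.\<close>
  have VU: "V * U = 1\<^sub>m n"
    using mat_exp_smult_add[OF A(1), of "cnj (\<i> * of_real t)" "\<i> * of_real t"]
      mat_exp_smult_0[OF A(1)] by (simp add: U_def V_def)
  have "A *\<^sub>v (U *\<^sub>v u) = (A * U) *\<^sub>v u"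
    using A UV u by simp
  also have "A * U = U * A"
    unfolding U_def by (rule mat_exp_smult_commute[OF A(1)])
  also have "(U * A) *\<^sub>v u = U *\<^sub>v (A *\<^sub>v u)"
    using A UV u by simp
  finally have "form A (U *\<^sub>v u) (U *\<^sub>v v) = (U *\<^sub>v (A *\<^sub>v u)) \<bullet>c (U *\<^sub>v v)"
    by (simp add: form_def)
  also have "\<dots> = (A *\<^sub>v u) \<bullet>c (V *\<^sub>v (U *\<^sub>v v))"
  proof (rule cscalar_prod_mult_mat_vec[OF UV])
    show "V $$ (j, i) = cnj (U $$ (i, j))" if "i < n" "j < n" for i j
      unfolding U_def V_def using A that by (rule hermitian_mat_exp_smult)
    show "A *\<^sub>v u \<in> carrier_vec n" "U *\<^sub>v v \<in> carrier_vec n"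
      using A(1) UV(1) u v by (simp_all add: mult_mat_vec_carrier)
  qed
  also have "V *\<^sub>v (U *\<^sub>v v) = v"
    using assoc_mult_mat_vec[OF UV(2,1) v] v by (simp add: VU)
  finally show ?thesis by (simp add: form_def)
qed

section \<open>Quadratic invariants of symplectic Runge-Kutta methods\<close>

text \<open>The condition splits each weight \<open>b i * b j\<close> into two parts that are
  exchanged by swapping the indices. As \<open>H\<close> is symmetric, both parts have the same
  sum.\<close>

lemma symplectic_double_sum:
  fixes H :: "'i \<Rightarrow> 'i \<Rightarrow> real"
  assumes sym: "\<And>i j. i \<in> I \<Longrightarrow> j \<in> I \<Longrightarrow> H i j = H j i"
    and symplectic: "\<And>i j. i \<in> I \<Longrightarrow> j \<in> I \<Longrightarrow> b i * a i j + b j * a j i = b i * b j"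
  shows "(\<Sum>i\<in>I. \<Sum>j\<in>I. b i * b j * H i j) = 2 * (\<Sum>i\<in>I. b i * (\<Sum>j\<in>I. a i j * H i j))"
proof -
  have "(\<Sum>i\<in>I. \<Sum>j\<in>I. b i * b j * H i j)
      = (\<Sum>i\<in>I. \<Sum>j\<in>I. b i * a i j * H i j + b j * a j i * H j i)"
    using sym by (intro sum.cong refl) (simp add: symplectic[symmetric] distrib_right)
  also have "\<dots> = (\<Sum>i\<in>I. \<Sum>j\<in>I. b i * a i j * H i j) + (\<Sum>i\<in>I. \<Sum>j\<in>I. b j * a j i * H j i)"
    by (simp add: sum.distrib)
  also have "(\<Sum>i\<in>I. \<Sum>j\<in>I. b j * a j i * H j i) = (\<Sum>i\<in>I. \<Sum>j\<in>I. b i * a i j * H i j)"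
    by (rule sum.swap)
  finally show ?thesis by (simp add: sum_distrib_left mult_ac)
qed

text \<open>Both sides agree up to first order in \<open>\<tau>\<close>; the second-order terms
  agree by the double sum identity for \<open>H i j = l i * l j\<close>.\<close>

lemma symplectic_square_step:
  fixes l :: "'i \<Rightarrow> real"
  assumes symplectic: "\<And>i j. i \<in> I \<Longrightarrow> j \<in> I \<Longrightarrow> b i * a i j + b j * a j i = b i * b j"
  shows "(q + \<tau> * (\<Sum>i\<in>I. b i * l i))\<^sup>2
    = q\<^sup>2 + 2 * \<tau> * (\<Sum>i\<in>I. b i * (q + \<tau> * (\<Sum>j\<in>I. a i j * l j)) * l i)"
proof -
  have "(\<Sum>i\<in>I. b i * l i)\<^sup>2 = (\<Sum>i\<in>I. \<Sum>j\<in>I. b i * b j * (l i * l j))"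
    by (simp add: power2_eq_square sum_product mult_ac)
  also have "\<dots> = 2 * (\<Sum>i\<in>I. b i * (\<Sum>j\<in>I. a i j * (l i * l j)))"
    by (rule symplectic_double_sum) (simp_all add: symplectic mult.commute)
  finally have sq: "(\<Sum>i\<in>I. b i * l i)\<^sup>2 = 2 * (\<Sum>i\<in>I. b i * (\<Sum>j\<in>I. a i j * (l i * l j)))" .
  have "(\<Sum>i\<in>I. b i * (q + \<tau> * (\<Sum>j\<in>I. a i j * l j)) * l i)
      = q * (\<Sum>i\<in>I. b i * l i) + \<tau> * (\<Sum>i\<in>I. b i * (\<Sum>j\<in>I. a i j * (l i * l j)))"
    by (simp add: algebra_simps sum.distrib sum_distrib_left sum_distrib_right)
  then show ?thesis
    by (simp add: power2_sum power_mult_distrib sq power2_eq_square[of \<tau>] algebra_simps)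
qed

text \<open>The same argument with \<open>H i j\<close> the real part of
  \<open>form A (\<kappa> i) (\<kappa> j)\<close>. For Hermitian \<open>A\<close> this real part is
  a symmetric bilinear form over the reals. The vectors with weights \<open>a i\<close> are the
  internal stages, the one with weights \<open>b\<close> is the new value.\<close>

lemma symplectic_form_step:
  assumes A: "A \<in> carrier_mat n n" "hermitian_mat A" and I: "finite I"
    and u: "u \<in> carrier_vec n" and k: "\<And>i. i \<in> I \<Longrightarrow> \<kappa> i \<in> carrier_vec n"
    and symplectic: "\<And>i j. i \<in> I \<Longrightarrow> j \<in> I \<Longrightarrow> b i * a i j + b j * a j i = b i * b j"
  defines "S \<equiv> \<lambda>w. finsum_vec TYPE(complex) n (\<lambda>i. of_real (w i) \<cdot>\<^sub>v \<kappa> i) I"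
  shows "Re (form A (u + of_real \<tau> \<cdot>\<^sub>v S b) (u + of_real \<tau> \<cdot>\<^sub>v S b))
    = Re (form A u u) + 2 * \<tau> * (\<Sum>i\<in>I. b i * Re (form A (u + of_real \<tau> \<cdot>\<^sub>v S (a i)) (\<kappa> i)))"
proof -
  define h where "h x y = Re (form A x y)" for x y
  have S: "S w \<in> carrier_vec n" for w
    unfolding S_def using k by (intro finsum_vec_closed) auto
  have sym: "h x y = h y x" if "x \<in> carrier_vec n" "y \<in> carrier_vec n" for x y
    using hermitian_form_commute[OF A that] by (simp add: h_def)
  have add: "h (x + of_real \<tau> \<cdot>\<^sub>v y) z = h x z + \<tau> * h y z"
    if "x \<in> carrier_vec n" "y \<in> carrier_vec n" "z \<in> carrier_vec n" for x y z
    using that A by (simp add: h_def form_add_left[of _ n] form_smult_left[of _ n])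
  have sum: "h (S w) x = (\<Sum>i\<in>I. w i * h (\<kappa> i) x)" if x: "x \<in> carrier_vec n" for w x
  proof -
    have "form A (S w) x = (\<Sum>i\<in>I. form A (of_real (w i) \<cdot>\<^sub>v \<kappa> i) x)"
      unfolding S_def using A x I k by (intro form_sum_left) auto
    also have "\<dots> = (\<Sum>i\<in>I. of_real (w i) * form A (\<kappa> i) x)"
      using A x k by (intro sum.cong refl form_smult_left) auto
    finally show ?thesis by (simp add: h_def)
  qed
  have SS: "h (S b) (S b) = 2 * (\<Sum>i\<in>I. b i * (\<Sum>j\<in>I. a i j * h (\<kappa> i) (\<kappa> j)))"
  proof -
    have "h (S b) (S b) = (\<Sum>i\<in>I. \<Sum>j\<in>I. b i * b j * h (\<kappa> i) (\<kappa> j))"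
      using k S sym by (simp add: sum sum_distrib_left mult_ac)
    also have "\<dots> = 2 * (\<Sum>i\<in>I. b i * (\<Sum>j\<in>I. a i j * h (\<kappa> i) (\<kappa> j)))"
      using k sym symplectic by (intro symplectic_double_sum) auto
    finally show ?thesis .
  qed
  have stage: "(\<Sum>i\<in>I. b i * h (u + of_real \<tau> \<cdot>\<^sub>v S (a i)) (\<kappa> i))
      = h (S b) u + \<tau> * (\<Sum>i\<in>I. b i * (\<Sum>j\<in>I. a i j * h (\<kappa> i) (\<kappa> j)))"
  proof -
    have "h (u + of_real \<tau> \<cdot>\<^sub>v S (a i)) (\<kappa> i)
        = h (\<kappa> i) u + \<tau> * (\<Sum>j\<in>I. a i j * h (\<kappa> i) (\<kappa> j))" if "i \<in> I" for i
    proof -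
      have "(\<Sum>j\<in>I. a i j * h (\<kappa> j) (\<kappa> i)) = (\<Sum>j\<in>I. a i j * h (\<kappa> i) (\<kappa> j))"
        using that k by (intro sum.cong refl) (simp add: sym)
      then show ?thesis
        using that k[OF that] u S sym[OF u k[OF that]] by (simp add: add sum)
    qed
    then have "(\<Sum>i\<in>I. b i * h (u + of_real \<tau> \<cdot>\<^sub>v S (a i)) (\<kappa> i))
        = (\<Sum>i\<in>I. b i * (h (\<kappa> i) u + \<tau> * (\<Sum>j\<in>I. a i j * h (\<kappa> i) (\<kappa> j))))"
      by (intro sum.cong) auto
    also have "\<dots> = h (S b) u + \<tau> * (\<Sum>i\<in>I. b i * (\<Sum>j\<in>I. a i j * h (\<kappa> i) (\<kappa> j)))"
      using u by (simp add: sum distrib_left sum.distrib sum_distrib_left mult_ac)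
    finally show ?thesis .
  qed
  let ?u' = "u + of_real \<tau> \<cdot>\<^sub>v S b"
  \<comment> \<open>Only expansion in the first argument is at hand; symmetry brings the second copy
    of \<open>?u'\<close> into that position.\<close>
  have "h ?u' ?u' = h u u + 2 * \<tau> * h (S b) u + \<tau> * \<tau> * h (S b) (S b)"
    using u S sym[of _ ?u'] sym[of u "S b"] by (simp add: add algebra_simps)
  also have "\<dots> = h u u + 2 * \<tau> * (\<Sum>i\<in>I. b i * h (u + of_real \<tau> \<cdot>\<^sub>v S (a i)) (\<kappa> i))"
    unfolding SS stage by (simp add: algebra_simps)
  finally show ?thesis by (simp add: h_def)
qed

section \<open>The spectral grid operators\<close>

lemma lap_h_carrier: "lap_h lx ly Nx Ny \<in> carrier_mat (Nx * Ny) (Nx * Ny)"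
  by (simp add: lap_h_def kron_def D2_def Let_def mult.commute)

text \<open>Exchanging the indices negates the argument of the sine, whose square is even, and
  leaves the parity of \<open>j + k + 1\<close> unchanged.\<close>

lemma D2_symmetric:
  assumes "i < N" "j < N"
  shows "D2 len N $$ (j, i) = D2 len N $$ (i, j)"
proof -
  have neg: "m * ((x - y) / 2) = - (m * ((y - x) / 2))" for m x y :: real
    by (simp add: field_simps)
  have "(1 / sin (m * ((x - y) / 2)))\<^sup>2 = (1 / sin (m * ((y - x) / 2)))\<^sup>2" for m x y :: real
    by (subst neg) (simp only: sin_minus minus_divide_right[symmetric] power2_minus)
  note sq = this[of "2 * pi / len" "real j * (len / real N)" "real i * (len / real N)"]
  show ?thesis
  proof (cases "i = j")
    case False
    with assms show ?thesis
      by (simp only: D2_def Let_def index_mat prod.case False not_sym[OF False] if_False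
          add.commute[of j i] sq)
  qed simp
qed

lemma lap_h_hermitian: "hermitian_mat (lap_h lx ly Nx Ny)"
proof -
  have D2: "D2 len N \<in> carrier_mat N N" for len N
    by (simp add: D2_def Let_def)
  have "lap_h lx ly Nx Ny $$ (q, r) = cnj (lap_h lx ly Nx Ny $$ (r, q))"
    if "q < Nx * Ny" "r < Nx * Ny" for q r
  proof -
    have "Nx > 0" using that(1) by (cases Nx) auto
    then have "r div Nx < Ny" "r mod Nx < Nx" "q div Nx < Ny" "q mod Nx < Nx"
      using that by (simp_all add: less_mult_imp_div_less mult.commute)
    then show ?thesis
      using that D2[of lx Nx] D2[of ly Ny] D2_symmetric[of "r div Nx" Ny "q div Nx" ly]
        D2_symmetric[of "r mod Nx" Nx "q mod Nx" lx]
      \<comment> \<open>The case distinctions evaluate the identity factors of the two Kronecker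
        products; what remains is real and symmetric by \<open>D2_symmetric\<close>.\<close>
      by (cases "r div Nx = q div Nx"; cases "r mod Nx = q mod Nx")
        (simp_all add: lap_h_def kron_def mult.commute[of Ny])
  qed
  then show ?thesis
    unfolding hermitian_mat_def square_mat.simps carrier_matD[OF lap_h_carrier] by blast
qed

text \<open>With \<open>k\<close> as the outer index, the inner sum runs over a block of
  \<open>Nx\<close> consecutive positions, and the \<open>Ny\<close> blocks together exhaust the
  vector.\<close>

lemma inner_h_cscalar_prod:
  assumes "u \<in> carrier_vec (Nx * Ny)" "v \<in> carrier_vec (Nx * Ny)"
  shows "inner_h hx hy Nx Ny u v = of_real (hx * hy) * (u \<bullet>c v)"
proof -
  have "(\<Sum>j = 0..<Nx. \<Sum>k = 0..<Ny. u $ (j + Nx * k) * cnj (v $ (j + Nx * k)))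
      = (\<Sum>k<Ny. \<Sum>j<Nx. u $ (j + Nx * k) * cnj (v $ (j + Nx * k)))"
    unfolding atLeast0LessThan by (rule sum.swap)
  also have "\<dots> = (\<Sum>k<Ny. \<Sum>r = k * Nx..<k * Nx + Nx. u $ r * cnj (v $ r))"
    using sum.shift_bounds_nat_ivl[of "\<lambda>r. u $ r * cnj (v $ r)" 0 "_ * Nx" Nx]
    by (simp add: atLeast0LessThan ac_simps)
  also have "\<dots> = (\<Sum>r<Nx * Ny. u $ r * cnj (v $ r))"
    by (simp add: sum.nat_group mult.commute)
  also have "\<dots> = u \<bullet>c v"
    using assms by (simp add: scalar_prod_def atLeast0LessThan)
  finally show ?thesis by (simp add: inner_h_def)
qed

section \<open>Energy balance of one step of the scheme\<close>

theorem theorem3p3: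
  fixes xl xr yl yr lx ly hx hy :: real
    and Nx Ny s M :: nat
    and \<beta> C0 \<tau> :: real
    and a :: "nat \<Rightarrow> nat \<Rightarrow> real" and b c :: "nat \<Rightarrow> real"
    and L :: "complex mat"
    and ip :: "complex vec \<Rightarrow> complex vec \<Rightarrow> complex"
    and g :: "complex vec \<Rightarrow> complex vec"
    and U :: "real \<Rightarrow> complex mat"
    and \<phi> :: "nat \<Rightarrow> complex vec" and p :: "nat \<Rightarrow> real"
    and \<phi>P kP :: "nat \<Rightarrow> nat \<Rightarrow> nat \<Rightarrow> complex vec"
    and pP lP :: "nat \<Rightarrow> nat \<Rightarrow> nat \<Rightarrow> real"
    and \<phi>S \<phi>C kC :: "nat \<Rightarrow> nat \<Rightarrow> complex vec"
    and pC lC :: "nat \<Rightarrow> nat \<Rightarrow> real"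
  assumes domain: "xl < xr" "yl < yr" "lx = xr - xl" "ly = yr - yl"
    and grid: "even Nx" "Nx > 0" "even Ny" "Ny > 0" "hx = lx / real Nx" "hy = ly / real Ny"
    and L: "L = lap_h lx ly Nx Ny"
    and ip: "ip = inner_h hx hy Nx Ny"
    and g: "g = normalized_cubic hx hy Nx Ny C0"
    and U: "U = (\<lambda>t. mat_exp ((\<i> * of_real t) \<cdot>\<^sub>m L))"
    and params: "C0 \<ge> 0" "\<tau> > 0" "s \<ge> 1" "M > 0"
    and c: "\<And>i. i \<in> {1..s} \<Longrightarrow> c i = (\<Sum>j = 1..s. a i j)"
    and c_distinct: "inj_on c {1..s}"
    and grid_functions:
      "\<And>n. \<phi> n \<in> carrier_vec (Nx * Ny)"
      "\<And>n i. i \<in> {1..s} \<Longrightarrow> \<phi>C n i \<in> carrier_vec (Nx * Ny)"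
      "\<And>n i. i \<in> {1..s} \<Longrightarrow> kC n i \<in> carrier_vec (Nx * Ny)"
    \<comment> \<open>prediction; the arguments of the arrays are time level, iteration, stage\<close>
    and pred_init: "\<And>n i. i \<in> {1..s} \<Longrightarrow> \<phi>P n 0 i = \<phi> n"
    and pred_l: "\<And>n m i. m < M \<Longrightarrow> i \<in> {1..s} \<Longrightarrow>
      lP n (Suc m) i = 2 * Re (ip ((\<i> \<cdot>\<^sub>m L) *\<^sub>v \<phi>P n m i) (g (\<phi>P n m i)))"
    and pred_p: "\<And>n m i. m < M \<Longrightarrow> i \<in> {1..s} \<Longrightarrow>
      pP n (Suc m) i = p n + \<tau> * (\<Sum>j = 1..s. a i j * lP n (Suc m) j)"
    and pred_k: "\<And>n m i. m < M \<Longrightarrow> i \<in> {1..s} \<Longrightarrow>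
      kP n (Suc m) i = (\<i> * of_real (\<beta> * pP n (Suc m) i)) \<cdot>\<^sub>v g (\<phi>P n m i)"
    and pred_\<phi>: "\<And>n m i. m < M \<Longrightarrow> i \<in> {1..s} \<Longrightarrow>
      \<phi>P n (Suc m) i = U (c i * \<tau>) *\<^sub>v \<phi> n + of_real \<tau> \<cdot>\<^sub>v
        finsum_vec TYPE(complex) (Nx * Ny)
          (\<lambda>j. of_real (a i j) \<cdot>\<^sub>v (U ((c i - c j) * \<tau>) *\<^sub>v kP n (Suc m) j)) {1..s}"
    and star: "\<And>n i. i \<in> {1..s} \<Longrightarrow> \<phi>S n i = \<phi>P n M i"
    and radicand_pos: "\<And>n m i. m \<le> M \<Longrightarrow> i \<in> {1..s} \<Longrightarrow> radicand hx hy Nx Ny C0 (\<phi>P n m i) > 0"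
    \<comment> \<open>correction; the arguments of the arrays are time level, stage\<close>
    and corr_\<phi>: "\<And>n i. i \<in> {1..s} \<Longrightarrow>
      \<phi>C n i = U (c i * \<tau>) *\<^sub>v \<phi> n + of_real \<tau> \<cdot>\<^sub>v
        finsum_vec TYPE(complex) (Nx * Ny)
          (\<lambda>j. of_real (a i j) \<cdot>\<^sub>v (U ((c i - c j) * \<tau>) *\<^sub>v kC n j)) {1..s}"
    and corr_p: "\<And>n i. i \<in> {1..s} \<Longrightarrow>
      pC n i = p n + \<tau> * (\<Sum>j = 1..s. a i j * lC n j)"
    and corr_k: "\<And>n i. i \<in> {1..s} \<Longrightarrow>
      kC n i = (\<i> * of_real (\<beta> * pC n i)) \<cdot>\<^sub>v g (\<phi>S n i)"
    and corr_l: "\<And>n i. i \<in> {1..s} \<Longrightarrow>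
      lC n i = 2 * Re (ip ((\<i> \<cdot>\<^sub>m L) *\<^sub>v \<phi>C n i) (g (\<phi>S n i)))"
    and step_\<phi>: "\<And>n. \<phi> (Suc n) = U \<tau> *\<^sub>v \<phi> n + of_real \<tau> \<cdot>\<^sub>v
        finsum_vec TYPE(complex) (Nx * Ny)
          (\<lambda>i. of_real (b i) \<cdot>\<^sub>v (U ((1 - c i) * \<tau>) *\<^sub>v kC n i)) {1..s}"
    and step_p: "\<And>n. p (Suc n) = p n + \<tau> * (\<Sum>i = 1..s. b i * lC n i)"
    and symplectic: "\<And>i j. i \<in> {1..s} \<Longrightarrow> j \<in> {1..s} \<Longrightarrow> b i * a i j + b j * a j i = b i * b j"
  shows "\<forall>n. energy_h hx hy Nx Ny L \<beta> C0 (\<phi> n) (p n) = energy_h hx hy Nx Ny L \<beta> C0 (\<phi> 0) (p 0)"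
proof -
  define d where "d = Nx * Ny"
  let ?I = "{1..s}"
  note carrier = grid_functions[folded d_def]
  have LC: "L \<in> carrier_mat d d" and LH: "hermitian_mat L"
    unfolding L d_def by (rule lap_h_carrier, rule lap_h_hermitian)
  have UC: "U t \<in> carrier_mat d d" for t
    using LC by (simp add: U)
  have U_add: "U (r + t) *\<^sub>v v = U r *\<^sub>v (U t *\<^sub>v v)" if "v \<in> carrier_vec d" for r t v
    using mat_exp_smult_add[OF LC, of "\<i> * of_real r" "\<i> * of_real t"]
      assoc_mult_mat_vec[OF UC UC that, of r t]
    by (simp add: U distrib_left)
  have isometry: "form L (U t *\<^sub>v u) (U t *\<^sub>v v) = form L u v"
    if "u \<in> carrier_vec d" "v \<in> carrier_vec d" for t u v
    unfolding U using LC LH that by (rule form_mat_exp_isometry)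
  have ip_form: "ip (L *\<^sub>v u) v = of_real (hx * hy) * form L u v"
    if "u \<in> carrier_vec d" "v \<in> carrier_vec d" for u v
    unfolding ip form_def using LC that by (intro inner_h_cscalar_prod) (simp_all add: d_def)
  \<comment> \<open>A Hermitian form is real on the diagonal, so the complex-valued energy is a real
    number and only real parts need to be followed.\<close>
  have energy: "energy_h hx hy Nx Ny L \<beta> C0 u q
      = of_real (hx * hy * Re (form L u u) + \<beta> / 2 * q\<^sup>2 - \<beta> / 2 * C0)"
    if u: "u \<in> carrier_vec d" for u q
  proof -
    have "Im (form L u u) = 0"
      using hermitian_form_commute[OF LC LH u u] by (simp add: complex_eq_iff)
    then show ?thesis
      using ip_form[OF u u] by (simp add: energy_h_def ip complex_eq_iff)
  qed
  have "energy_h hx hy Nx Ny L \<beta> C0 (\<phi> (Suc n)) (p (Suc n))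
      = energy_h hx hy Nx Ny L \<beta> C0 (\<phi> n) (p n)" for n
  proof -
    define \<kappa> where "\<kappa> i = U (- c i * \<tau>) *\<^sub>v kC n i" for i
    define S where "S w = finsum_vec TYPE(complex) d (\<lambda>i. of_real (w i) \<cdot>\<^sub>v \<kappa> i) ?I" for w
    have \<kappa>C: "\<kappa> i \<in> carrier_vec d" if "i \<in> ?I" for i
      unfolding \<kappa>_def using UC carrier(3)[OF that] by (rule mult_mat_vec_carrier)
    have SC: "S w \<in> carrier_vec d" for w
      unfolding S_def using \<kappa>C by (intro finsum_vec_closed) auto
    \<comment> \<open>The propagator from time 0 to \<open>r * \<tau>\<close> factors out. Taking
      \<open>r = c i\<close>, \<open>w = a i\<close> gives a correction stage, and
      \<open>r = 1\<close>, \<open>w = b\<close> gives the update.\<close>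
    have pull: "U (r * \<tau>) *\<^sub>v \<phi> n + of_real \<tau> \<cdot>\<^sub>v finsum_vec TYPE(complex) d
          (\<lambda>i. of_real (w i) \<cdot>\<^sub>v (U ((r - c i) * \<tau>) *\<^sub>v kC n i)) ?I
        = U (r * \<tau>) *\<^sub>v (\<phi> n + of_real \<tau> \<cdot>\<^sub>v S w)" for r w
    proof -
      have "of_real (w i) \<cdot>\<^sub>v (U ((r - c i) * \<tau>) *\<^sub>v kC n i) = U (r * \<tau>) *\<^sub>v (of_real (w i) \<cdot>\<^sub>v \<kappa> i)"
        if i: "i \<in> ?I" for i
        using U_add[OF carrier(3)[OF i], of "r * \<tau>" "- c i * \<tau>"] mult_mat_vec[OF UC \<kappa>C[OF i]]
        by (simp add: \<kappa>_def left_diff_distrib)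
      then have "finsum_vec TYPE(complex) d
          (\<lambda>i. of_real (w i) \<cdot>\<^sub>v (U ((r - c i) * \<tau>) *\<^sub>v kC n i)) ?I = U (r * \<tau>) *\<^sub>v S w"
        unfolding S_def using UC \<kappa>C
        by (subst mult_mat_vec_finsum_vec[of _ d d])
          (auto intro!: finsum_vec_cong mult_mat_vec_carrier[OF UC])
      then show ?thesis
        using mult_add_distrib_mat_vec[OF UC carrier(1), of "of_real \<tau> \<cdot>\<^sub>v S w"]
          mult_mat_vec[OF UC SC] SC by simp
    qed
    have step: "\<phi> (Suc n) = U \<tau> *\<^sub>v (\<phi> n + of_real \<tau> \<cdot>\<^sub>v S b)"
      using pull[of 1 b] unfolding step_\<phi>[of n] d_def mult_1 .
    have stage: "hx * hy * Re (form L (\<phi> n + of_real \<tau> \<cdot>\<^sub>v S (a i)) (\<kappa> i))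
        = - (\<beta> / 2 * (pC n i * lC n i))" if i: "i \<in> ?I" for i
    proof -
      let ?g = "g (\<phi>S n i)"
      \<comment> \<open>Scaling keeps the dimension, so the dimension of \<open>?g\<close> can be
        read off from that of \<open>kC n i\<close>.\<close>
      have gC: "?g \<in> carrier_vec d"
      proof (rule carrier_vecI)
        show "dim_vec ?g = d"
          using carrier_vecD[OF carrier(3)[OF i, of n]]
          by (simp only: corr_k[OF i] index_smult_vec)
      qed
      have "U (c i * \<tau>) *\<^sub>v \<kappa> i = U 0 *\<^sub>v kC n i"
        unfolding \<kappa>_def U_add[OF carrier(3)[OF i], symmetric] by simp
      also have "\<dots> = kC n i"
        using mat_exp_smult_0[OF LC] carrier(3)[OF i, of n] by (simp add: U)
      finally have "kC n i = U (c i * \<tau>) *\<^sub>v \<kappa> i" ..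
      moreover have "\<phi>C n i = U (c i * \<tau>) *\<^sub>v (\<phi> n + of_real \<tau> \<cdot>\<^sub>v S (a i))"
        using pull[of "c i" "a i"] unfolding corr_\<phi>[OF i, of n] d_def .
      ultimately have "form L (\<phi> n + of_real \<tau> \<cdot>\<^sub>v S (a i)) (\<kappa> i) = form L (\<phi>C n i) (kC n i)"
        using isometry \<kappa>C[OF i] SC carrier(1) by simp
      \<comment> \<open>The factor \<open>\<i>\<close> of \<open>kC n i\<close> stands in the
        conjugated argument, which produces the minus sign.\<close>
      also have "\<dots> = - (\<i> * of_real (\<beta> * pC n i) * form L (\<phi>C n i) ?g)"
        using form_smult_right[OF LC carrier(2)[OF i] gC] by (simp add: corr_k[OF i])
      finally have form: "form L (\<phi> n + of_real \<tau> \<cdot>\<^sub>v S (a i)) (\<kappa> i)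
        = - (\<i> * of_real (\<beta> * pC n i) * form L (\<phi>C n i) ?g)" .
      have "(\<i> \<cdot>\<^sub>m L) *\<^sub>v \<phi>C n i = \<i> \<cdot>\<^sub>v (L *\<^sub>v \<phi>C n i)"
        using LC carrier(2)[OF i, of n] by (intro eq_vecI) auto
      moreover have "L *\<^sub>v \<phi>C n i \<in> carrier_vec d"
        using LC carrier(2)[OF i] by (rule mult_mat_vec_carrier)
      ultimately have "ip ((\<i> \<cdot>\<^sub>m L) *\<^sub>v \<phi>C n i) ?g = of_real (hx * hy) * (\<i> * form L (\<phi>C n i) ?g)"
        using gC by (simp add: ip inner_h_cscalar_prod form_def flip: d_def)
      \<comment> \<open>In \<open>lC n i\<close> the factor \<open>\<i>\<close> stands in the linear
        argument. Hence both \<open>lC n i\<close> and the real part in \<open>form\<close> are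
        multiples of the same imaginary part, and eliminating it yields the factor
        \<open>- \<beta> / 2\<close>.\<close>
      then have "lC n i = - 2 * (hx * hy) * Im (form L (\<phi>C n i) ?g)"
        using corr_l[OF i, of n] by simp
      then show ?thesis by (simp add: form)
    qed
    \<comment> \<open>The outer propagator \<open>U \<tau>\<close> drops out by the isometry, which
      leaves a plain Runge-Kutta step in the variables \<open>\<kappa> i\<close>.\<close>
    have "Re (form L (\<phi> (Suc n)) (\<phi> (Suc n)))
        = Re (form L (\<phi> n + of_real \<tau> \<cdot>\<^sub>v S b) (\<phi> n + of_real \<tau> \<cdot>\<^sub>v S b))"
      unfolding step using SC carrier(1) by (simp add: isometry)
    also have "\<dots> = Re (form L (\<phi> n) (\<phi> n))
        + 2 * \<tau> * (\<Sum>i\<in>?I. b i * Re (form L (\<phi> n + of_real \<tau> \<cdot>\<^sub>v S (a i)) (\<kappa> i)))"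
      unfolding S_def using LC LH carrier(1) \<kappa>C symplectic by (intro symplectic_form_step) auto
    finally have "hx * hy * Re (form L (\<phi> (Suc n)) (\<phi> (Suc n)))
        = hx * hy * Re (form L (\<phi> n) (\<phi> n))
        + 2 * \<tau> * (\<Sum>i\<in>?I. b i * (hx * hy * Re (form L (\<phi> n + of_real \<tau> \<cdot>\<^sub>v S (a i)) (\<kappa> i))))"
      by (simp add: algebra_simps sum_distrib_left)
    also have "(\<Sum>i\<in>?I. b i * (hx * hy * Re (form L (\<phi> n + of_real \<tau> \<cdot>\<^sub>v S (a i)) (\<kappa> i))))
        = (\<Sum>i\<in>?I. b i * - (\<beta> / 2 * (pC n i * lC n i)))"
      by (rule sum.cong[OF refl]) (simp only: stage)
    also have "\<dots> = - (\<beta> / 2 * (\<Sum>i\<in>?I. b i * pC n i * lC n i))"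
      by (simp add: sum_negf sum_distrib_left mult_ac)
    finally have form: "hx * hy * Re (form L (\<phi> (Suc n)) (\<phi> (Suc n)))
        = hx * hy * Re (form L (\<phi> n) (\<phi> n)) - \<beta> * \<tau> * (\<Sum>i\<in>?I. b i * pC n i * lC n i)"
      by (simp add: algebra_simps)
    \<comment> \<open>Multiplied by \<open>\<beta> / 2\<close>, this increment is exactly what the
      form has lost.\<close>
    have "(p (Suc n))\<^sup>2 = (p n)\<^sup>2 + 2 * \<tau> * (\<Sum>i\<in>?I. b i * pC n i * lC n i)"
      using symplectic_square_step[of ?I b a "p n" \<tau> "lC n", OF symplectic]
      by (simp add: step_p corr_p)
    then have "hx * hy * Re (form L (\<phi> (Suc n)) (\<phi> (Suc n))) + \<beta> / 2 * (p (Suc n))\<^sup>2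
        = hx * hy * Re (form L (\<phi> n) (\<phi> n)) + \<beta> / 2 * (p n)\<^sup>2"
      using form by (simp add: algebra_simps)
    then show ?thesis
      by (simp only: energy[OF carrier(1)])
  qed
  then show ?thesis
    by (intro allI, induct_tac n) simp_all
qed

end
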